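(* Let $J \ge 1$ and $n_1,\ldots,n_J \ge 1$ be integers, and fix a group $j \in \{1,\ldots,J\}$ and a miscoverage level $\alpha_j \in (0,1)$. Let $Z = \{Z_{i,k} : i=1,\ldots,n_k,\ k=1,\ldots,J\}$ be random data with $Z_{i,k} = (Y_{i,k},X_{i,k}) \in \mathbb{R}\times\mathbb{R}^d$, and let $Z_{n_j+1,j} = (Y_{n_j+1,j},X_{n_j+1,j})$ be one further random data point in group $j$. Assume that the augmented collection $\{Z, Z_{n_j+1,j}\}$ is partially exchangeable (its joint distribution is invariant under permutations within groups, group $j$ now having $n_j+1$ elements). Let $\sigma_{Z_{-j}}(\,\cdot\,;\,\cdot\,)$ be a (measurable, real-valued) within-group conformity measure for group $j$, possibly depending on the data $Z_{-j}$ of the other groups, which for each value of $Z_{-j}$ is invariant to permutations of its first argument $Z_{1:n_j+1,j}$. Let $C_{\alpha_j}(X_{n_j+1,j})$ be the group conformal predictive set for group $j$ built from this conformity measure. Then $$\mathbb{P}\left(Y_{n_j+1,j} \in C_{\alpha_j}(X_{n_j+1,j})\right) \ge 1-\alpha_j,$$ where $\mathbb{P}$ is the joint distribution of $\{Z, Z_{n_j+1,j}\}$.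
   Context: Notation: $Z_{1:m,k} = (Z_{1,k},\ldots,Z_{m,k})$, and $Z_{-j} = \{Z_{i,k} : k\neq j,\ i=1,\ldots,n_k\}$ is the data from all groups other than $j$. Partial exchangeability: a collection of random variables arranged in $J$ groups of sizes $m_1,\ldots,m_J$ is partially exchangeable if for all permutations $\pi_k$ of $\{1,\ldots,m_k\}$, $k=1,\ldots,J$, the joint distribution of $(Z_{1:m_1,1},\ldots,Z_{1:m_J,J})$ equals that of $(Z_{\pi_1(1),1},\ldots,Z_{\pi_1(m_1),1},\ \ldots,\ Z_{\pi_J(1),J},\ldots,Z_{\pi_J(m_J),J})$. For the augmented collection $\{Z,Z_{n_j+1,j}\}$ one has $m_j = n_j+1$ and $m_k = n_k$ for $k\ne j$. Within-group conformity measure for group $j$: for each value of $Z_{-j}$, a real-valued function $\sigma_{Z_{-j}}(z_{1:n_j+1}; z)$ of a list of $n_j+1$ data points and a single data point. It is invariant to permutation of its first argument if $\sigma_{Z_{-j}}(z_{\pi(1)},\ldots,z_{\pi(n_j+1)}; z) = \sigma_{Z_{-j}}(z_1,\ldots,z_{n_j+1}; z)$ for every permutation $\pi$ of $\{1,\ldots,n_j+1\}$. The conformity scores are $\sigma_{i,j} := \sigma_{Z_{-j}}(Z_{1:n_j+1,j}; Z_{i,j})$ for $i=1,\ldots,n_j+1$. Group conformal predictive set: for $y\in\mathbb{R}$, compute the scores $\sigma_{1,j},\ldots,\sigma_{n_j+1,j}$ with the plug-in value $Z_{n_j+1,j} = (y, X_{n_j+1,j})$ (the points $Z_{1:n_j,j}$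 and $Z_{-j}$ being the observed data), and set $$\pi_j(y) = \frac{1}{n_j+1}\sum_{i=1}^{n_j+1}\mathbf{1}\left(\sigma_{i,j}\le\sigma_{n_j+1,j}\right),\qquad C_{\alpha_j}(X_{n_j+1,j}) = \{y\in\mathbb{R} : \pi_j(y) > \alpha_j\}.$$ (Thus $C_{\alpha_j}(X_{n_j+1,j})$ depends on $Z$ as well as on $X_{n_j+1,j}$.) *)

theory Defs
  imports "HOL-Probability.Probability" "HOL-Combinatorics.Permutations"
begin

text \<open>
  Data are arranged in groups \<open>1, \<dots>, J\<close>, group \<open>k\<close> having size \<open>m k\<close>; the \<open>i\<close>-th point of
  group \<open>k\<close> carries the index \<open>(i, k)\<close>.
\<close>

definition group_index :: "nat \<Rightarrow> (nat \<Rightarrow> nat) \<Rightarrow> (nat \<times> nat) set" where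
  "group_index J m = {(i, k). k \<in> {1..J} \<and> i \<in> {1..m k}}"

definition other_index :: "nat \<Rightarrow> (nat \<Rightarrow> nat) \<Rightarrow> nat \<Rightarrow> (nat \<times> nat) set" where
  "other_index J n j = {(i, k) \<in> group_index J n. k \<noteq> j}"

definition partially_exchangeable ::
  "'w measure \<Rightarrow> nat \<Rightarrow> (nat \<Rightarrow> nat) \<Rightarrow> (nat \<Rightarrow> nat \<Rightarrow> 'w \<Rightarrow> 'z::topological_space) \<Rightarrow> bool" where
  "partially_exchangeable M J m Z \<longleftrightarrow>
     (\<forall>\<pi>. (\<forall>k\<in>{1..J}. \<pi> k permutes {1..m k}) \<longrightarrow>
        distr M (\<Pi>\<^sub>M p\<in>group_index J m. borel) (\<lambda>w. \<lambda>(i, k)\<in>group_index J m. Z (\<pi> k i) k w) =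
        distr M (\<Pi>\<^sub>M p\<in>group_index J m. borel) (\<lambda>w. \<lambda>(i, k)\<in>group_index J m. Z i k w))"

definition other_groups ::
  "nat \<Rightarrow> (nat \<Rightarrow> nat) \<Rightarrow> nat \<Rightarrow> (nat \<Rightarrow> nat \<Rightarrow> 'w \<Rightarrow> 'z) \<Rightarrow> 'w \<Rightarrow> (nat \<times> nat \<Rightarrow> 'z)" where
  "other_groups J n j Z w = (\<lambda>(i, k)\<in>other_index J n j. Z i k w)"

text \<open>
  A conformity measure \<open>\<sigma> r v z\<close> takes the value \<open>r\<close> of the data of the other groups, a list
  \<open>v = (v 1, \<dots>, v (n j + 1))\<close> of points, encoded as an extensional function on \<open>{1..n j + 1}\<close>,
  and a single point \<open>z\<close>. It is measurable jointly in all its arguments.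
\<close>

definition conformity_measure ::
  "nat \<Rightarrow> (nat \<Rightarrow> nat) \<Rightarrow> nat \<Rightarrow>
    ((nat \<times> nat \<Rightarrow> 'z::topological_space) \<Rightarrow> (nat \<Rightarrow> 'z) \<Rightarrow> 'z \<Rightarrow> real) \<Rightarrow> bool" where
  "conformity_measure J n j \<sigma> \<longleftrightarrow>
     (\<lambda>(r, v, z). \<sigma> r v z) \<in> borel_measurable
       ((\<Pi>\<^sub>M p\<in>other_index J n j. borel) \<Otimes>\<^sub>M (\<Pi>\<^sub>M i\<in>{1..n j + 1}. borel) \<Otimes>\<^sub>M borel)"

definition permutation_invariant ::
  "nat \<Rightarrow> (nat \<Rightarrow> nat) \<Rightarrow> nat \<Rightarrow>
    ((nat \<times> nat \<Rightarrow> 'z) \<Rightarrow> (nat \<Rightarrow> 'z) \<Rightarrow> 'z \<Rightarrow> real) \<Rightarrow> bool" where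
  "permutation_invariant J n j \<sigma> \<longleftrightarrow>
     (\<forall>r \<in> extensional (other_index J n j). \<forall>v \<in> extensional {1..n j + 1}. \<forall>z \<pi>.
        \<pi> permutes {1..n j + 1} \<longrightarrow> \<sigma> r (\<lambda>i\<in>{1..n j + 1}. v (\<pi> i)) z = \<sigma> r v z)"

text \<open>
  Below \<open>N\<close> is the number of observed points of the group and \<open>s\<close> is the conformity measure for
  a fixed value of the data of the other groups.
\<close>

definition plug_in :: "nat \<Rightarrow> (nat \<Rightarrow> 'z) \<Rightarrow> 'z \<Rightarrow> (nat \<Rightarrow> 'z)" where
  "plug_in N v z = (\<lambda>i\<in>{1..N + 1}. if i = N + 1 then z else v i)"

definition conformal_pvalue ::
  "nat \<Rightarrow> ((nat \<Rightarrow> real \<times> 'x) \<Rightarrow> real \<times> 'x \<Rightarrow> real) \<Rightarrow> (nat \<Rightarrow> real \<times> 'x) \<Rightarrow> 'x \<Rightarrow> real \<Rightarrow> real" where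
  "conformal_pvalue N s v x y =
     (let u = plug_in N v (y, x)
      in 1 / real (N + 1) * (\<Sum>i = 1..N + 1. of_bool (s u (u i) \<le> s u (u (N + 1)))))"

definition conformal_set ::
  "nat \<Rightarrow> ((nat \<Rightarrow> real \<times> 'x) \<Rightarrow> real \<times> 'x \<Rightarrow> real) \<Rightarrow> real \<Rightarrow> (nat \<Rightarrow> real \<times> 'x) \<Rightarrow> 'x \<Rightarrow> real set" where
  "conformal_set N s \<alpha> v x = {y. conformal_pvalue N s v x y > \<alpha>}"

end

theory Submission
  imports Defs
begin

text \<open>
  Write \<open>R l\<close> for the number of scores that are at most the \<open>l\<close>-th one, among the
  \<open>N = n j + 1\<close> scores of group \<open>j\<close>. The event of miscoverage is \<open>R N \<le> \<alpha> N\<close>. Swapping the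
  points \<open>l\<close> and \<open>N\<close> of group \<open>j\<close> turns \<open>R N\<close> into \<open>R l\<close>, so by partial exchangeability all
  events \<open>R l \<le> \<alpha> N\<close> have the same probability. For any outcome at most \<open>\<alpha> N\<close> of these \<open>N\<close>
  events occur; taking expectations bounds their common probability by \<open>\<alpha>\<close>.
\<close>

text \<open>Ties count in full, as in \<open>conformal_pvalue\<close>. The value is real because it
  is compared with a threshold that need not be an integer.\<close>

definition rank_in :: "'i set \<Rightarrow> ('i \<Rightarrow> 'a::linorder) \<Rightarrow> 'i \<Rightarrow> real" where
  "rank_in A f l = (\<Sum>i\<in>A. of_bool (f i \<le> f l))"

lemma rank_in_eq_card: "finite A \<Longrightarrow> rank_in A f l = card {i\<in>A. f i \<le> f l}"
  by (simp add: rank_in_def of_bool_def sum.inter_filter[symmetric])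

text \<open>Among the indices of rank at most \<open>c\<close>, take one with the largest score.
  Every index of this set is then counted in the rank of the chosen one, and that rank is at most
  \<open>c\<close>. Ties do not disturb the argument.\<close>

lemma card_rank_in_le:
  assumes "finite A" "0 \<le> c"
  shows "real (card {l\<in>A. rank_in A f l \<le> c}) \<le> c"
proof (cases "{l\<in>A. rank_in A f l \<le> c} = {}")
  case True
  then show ?thesis using assms(2) by (simp only: card.empty of_nat_0)
next
  case False
  let ?B = "{l\<in>A. rank_in A f l \<le> c}"
  have fB: "finite ?B" using assms(1) by simp
  then have "Max (f ` ?B) \<in> f ` ?B" using False by (intro Max_in) auto
  then obtain l where l: "l \<in> ?B" "Max (f ` ?B) = f l" by blast
  have "f i \<le> f l" if "i \<in> ?B" for i
    using Max_ge[of "f ` ?B" "f i"] fB that l(2) by auto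
  then have "?B \<subseteq> {i\<in>A. f i \<le> f l}" by blast
  then have "card ?B \<le> card {i\<in>A. f i \<le> f l}" using assms(1) by (intro card_mono) auto
  then have "real (card ?B) \<le> rank_in A f l" using assms(1) by (simp add: rank_in_eq_card)
  then show ?thesis using l(1) by simp
qed

lemma rank_in_permute:
  assumes "\<pi> permutes A" "\<And>i. i \<in> A \<Longrightarrow> g i = f (\<pi> i)" "l \<in> A"
  shows "rank_in A g l = rank_in A f (\<pi> l)"
proof -
  have "rank_in A g l = (\<Sum>i\<in>A. of_bool (f (\<pi> i) \<le> f (\<pi> l)))"
    using assms by (simp add: rank_in_def)
  also have "\<dots> = rank_in A f (\<pi> l)"
    unfolding rank_in_def
    using sum.permute[OF assms(1), of "\<lambda>i. of_bool (f i \<le> f (\<pi> l))", symmetric] unfolding o_def .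
  finally show ?thesis .
qed

lemma borel_measurable_rank_in:
  fixes S :: "'i \<Rightarrow> 'a \<Rightarrow> real"
  assumes S: "\<And>i. i \<in> A \<Longrightarrow> S i \<in> borel_measurable M" and l: "l \<in> A"
  shows "(\<lambda>w. rank_in A (\<lambda>i. S i w) l) \<in> borel_measurable M"
  unfolding rank_in_def of_bool_def
proof (intro borel_measurable_sum)
  fix i assume "i \<in> A"
  note [measurable] = S[OF this] S[OF l]
  show "(\<lambda>w. if S i w \<le> S l w then 1 else 0 :: real) \<in> borel_measurable M" by measurable
qed

text \<open>The counting argument, separated from exchangeability: all that is asked of the joint
  law of the scores is that the rank events be equally likely.\<close>

lemma (in prob_space) prob_rank_in_le:
  fixes S :: "'i \<Rightarrow> 'a \<Rightarrow> real"
  assumes A: "finite A" "a \<in> A" and c: "0 \<le> c"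
    and S: "\<And>i. i \<in> A \<Longrightarrow> random_variable borel (S i)"
    and eq: "\<And>l. l \<in> A \<Longrightarrow>
      \<P>(w in M. rank_in A (\<lambda>i. S i w) l \<le> c) = \<P>(w in M. rank_in A (\<lambda>i. S i w) a \<le> c)"
  shows "card A * \<P>(w in M. rank_in A (\<lambda>i. S i w) a \<le> c) \<le> c"
proof -
  let ?E = "\<lambda>l. {w \<in> space M. rank_in A (\<lambda>i. S i w) l \<le> c}"
  have E: "?E l \<in> events" if "l \<in> A" for l
    by (intro borel_measurable_le borel_measurable_rank_in borel_measurable_const S that)
  have "card A * prob (?E a) = (\<Sum>l\<in>A. prob (?E l))" using eq by simp
  also have "\<dots> = (\<Sum>l\<in>A. expectation (indicator (?E l)))" using E by simp
  also have "\<dots> = expectation (\<lambda>w. \<Sum>l\<in>A. indicator (?E l) w)"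
    using E by (subst Bochner_Integration.integral_sum) (auto simp: emeasure_eq_measure)
  also have "\<dots> \<le> expectation (\<lambda>w. c)"
  \<comment> \<open>At each outcome the sum of the indicators is the number of events that occur, so
    the deterministic bound \<open>card_rank_in_le\<close> applies pointwise.\<close>
  proof (intro integral_mono)
    fix w assume "w \<in> space M"
    then have "(\<Sum>l\<in>A. indicator (?E l) w :: real) = card {l\<in>A. rank_in A (\<lambda>i. S i w) l \<le> c}"
      using A(1) by (simp add: indicator_def of_bool_def sum.inter_filter[symmetric])
    then show "(\<Sum>l\<in>A. indicator (?E l) w) \<le> c" using card_rank_in_le[OF A(1) c] by simp
  qed (use E in \<open>auto simp: emeasure_eq_measure\<close>)
  finally show ?thesis by (simp add: prob_space)
qed

text \<open>The score is a function of the whole augmented array \<open>x\<close>, because partial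
  exchangeability speaks of the law of that array. Rank events thus become events of the product
  space.\<close>

definition group_score ::
  "nat \<Rightarrow> (nat \<Rightarrow> nat) \<Rightarrow> nat \<Rightarrow>
    ((nat \<times> nat \<Rightarrow> 'z) \<Rightarrow> (nat \<Rightarrow> 'z) \<Rightarrow> 'z \<Rightarrow> real) \<Rightarrow> (nat \<times> nat \<Rightarrow> 'z) \<Rightarrow> nat \<Rightarrow> real" where
  "group_score J n j \<sigma> x l =
     \<sigma> (restrict x (other_index J n j)) (\<lambda>i\<in>{1..n j + 1}. x (i, j)) (x (l, j))"

text \<open>The size \<open>m\<close> of group \<open>j\<close> is arbitrary here, since
  \<open>other_index\<close> leaves that group out.\<close>

lemma other_index_subset: "other_index J n j \<subseteq> group_index J (n(j := m))"
  by (auto simp: other_index_def group_index_def)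

lemma mem_group_index_augmented:
  "j \<in> {1..J} \<Longrightarrow> i \<in> {1..n j + 1} \<Longrightarrow> (i, j) \<in> group_index J (n(j := n j + 1))"
  by (auto simp: group_index_def)

lemma measurable_group_score:
  assumes "conformity_measure J n j \<sigma>" "j \<in> {1..J}" "l \<in> {1..n j + 1}"
  shows "(\<lambda>x. group_score J n j \<sigma> x l) \<in>
    borel_measurable (\<Pi>\<^sub>M p\<in>group_index J (n(j := n j + 1)). borel)"
proof -
  let ?P = "\<Pi>\<^sub>M p\<in>group_index J (n(j := n j + 1)). borel"
  note mem = mem_group_index_augmented[OF assms(2), where n = n]
  have "(\<lambda>x. restrict x (other_index J n j)) \<in> ?P \<rightarrow>\<^sub>M (\<Pi>\<^sub>M p\<in>other_index J n j. borel)"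
    by (rule measurable_restrict_subset[OF other_index_subset])
  moreover have "(\<lambda>x. \<lambda>i\<in>{1..n j + 1}. x (i, j)) \<in> ?P \<rightarrow>\<^sub>M (\<Pi>\<^sub>M i\<in>{1..n j + 1}. borel)"
    by (intro measurable_restrict measurable_component_singleton mem)
  moreover have "(\<lambda>x. x (l, j)) \<in> ?P \<rightarrow>\<^sub>M borel"
    by (intro measurable_component_singleton mem assms(3))
  ultimately have "(\<lambda>x. (restrict x (other_index J n j), \<lambda>i\<in>{1..n j + 1}. x (i, j), x (l, j)))
      \<in> ?P \<rightarrow>\<^sub>M ((\<Pi>\<^sub>M p\<in>other_index J n j. borel) \<Otimes>\<^sub>M (\<Pi>\<^sub>M i\<in>{1..n j + 1}. borel) \<Otimes>\<^sub>M borel)"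
    by (intro measurable_Pair)
  from measurable_compose[OF this assms(1)[unfolded conformity_measure_def]]
  show ?thesis by (simp add: group_score_def)
qed

text \<open>Permuting group \<open>j\<close> alters the list of points and the evaluated point, but
  not the data of the other groups. Invariance in the list absorbs the first change, so only the
  evaluated index moves.\<close>

lemma group_score_permute:
  assumes "permutation_invariant J n j \<sigma>" "\<pi> permutes {1..n j + 1}" "l \<in> {1..n j + 1}"
    and "\<And>p. p \<in> other_index J n j \<Longrightarrow> x' p = x p"
    and x': "\<And>i. i \<in> {1..n j + 1} \<Longrightarrow> x' (i, j) = x (\<pi> i, j)"
  shows "group_score J n j \<sigma> x' l = group_score J n j \<sigma> x (\<pi> l)"
proof -
  let ?v = "\<lambda>i\<in>{1..n j + 1}. x (i, j)"
  have "restrict x' (other_index J n j) = restrict x (other_index J n j)"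
    using assms(4) by (intro restrict_ext)
  \<comment> \<open>The list is rewritten through \<open>?v\<close>, which is extensional as
    \<open>permutation_invariant\<close> requires.\<close>
  moreover have "(\<lambda>i\<in>{1..n j + 1}. x' (i, j)) = (\<lambda>i\<in>{1..n j + 1}. ?v (\<pi> i))"
    using x' permutes_in_image[OF assms(2)] by (intro restrict_ext) simp
  moreover have "\<sigma> (restrict x (other_index J n j)) (\<lambda>i\<in>{1..n j + 1}. ?v (\<pi> i)) z =
      \<sigma> (restrict x (other_index J n j)) ?v z" for z
    by (rule assms(1)[unfolded permutation_invariant_def, rule_format, OF _ _ assms(2)])
      (rule restrict_extensional)+
  ultimately show ?thesis using x'[OF assms(3)] by (simp add: group_score_def)
qed

text \<open>The candidate response is the true one, so plugging it in restores the actual list of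
  \<open>n j + 1\<close> points. The p-value is then the rank of the last score divided by
  \<open>n j + 1\<close>.\<close>

lemma mem_conformal_set_iff:
  fixes Z :: "nat \<Rightarrow> nat \<Rightarrow> 'w \<Rightarrow> real \<times> 'x"
    and n :: "nat \<Rightarrow> nat"
  assumes "j \<in> {1..J}"
  defines "x \<equiv> \<lambda>w. \<lambda>(i, k)\<in>group_index J (n(j := n j + 1)). Z i k w"
  shows "fst (Z (n j + 1) j w) \<in> conformal_set (n j) (\<sigma> (other_groups J n j Z w)) \<alpha>
      (\<lambda>i. Z i j w) (snd (Z (n j + 1) j w)) \<longleftrightarrow>
    \<alpha> * real (n j + 1) < rank_in {1..n j + 1} (group_score J n j \<sigma> (x w)) (n j + 1)"
proof -
  note mem = mem_group_index_augmented[OF assms(1), where n = n]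
  have r: "other_groups J n j Z w = restrict (x w) (other_index J n j)"
    unfolding other_groups_def x_def
    using other_index_subset[of J n j "n j + 1"] by (intro restrict_ext) auto
  have u: "plug_in (n j) (\<lambda>i. Z i j w) (Z (n j + 1) j w) = (\<lambda>i\<in>{1..n j + 1}. x w (i, j))"
    (is "?u = ?v") unfolding plug_in_def x_def using mem by (intro restrict_ext) auto
  have s: "\<sigma> (other_groups J n j Z w) ?u (?u i) = group_score J n j \<sigma> (x w) i"
    if "i \<in> {1..n j + 1}" for i
    unfolding r u using that by (simp add: group_score_def)
  have "conformal_pvalue (n j) (\<sigma> (other_groups J n j Z w)) (\<lambda>i. Z i j w)
      (snd (Z (n j + 1) j w)) (fst (Z (n j + 1) j w)) =
    1 / real (n j + 1) * rank_in {1..n j + 1} (group_score J n j \<sigma> (x w)) (n j + 1)"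
    unfolding conformal_pvalue_def Let_def rank_in_def prod.collapse
    by (intro arg_cong2[where f = "(*)"] refl sum.cong) (simp_all only: s, simp add: s[simplified])
  then show ?thesis
    by (simp only: conformal_set_def mem_Collect_eq) (simp add: pos_less_divide_eq)
qed

lemma prob_group_rank_swap:
  fixes Z :: "nat \<Rightarrow> nat \<Rightarrow> 'w \<Rightarrow> 'z::topological_space"
    and n :: "nat \<Rightarrow> nat"
  assumes j: "j \<in> {1..J}"
    and Z: "\<forall>(i, k)\<in>group_index J (n(j := n j + 1)). Z i k \<in> borel_measurable M"
    and exch: "partially_exchangeable M J (n(j := n j + 1)) Z"
    and cm: "conformity_measure J n j \<sigma>"
    and inv: "permutation_invariant J n j \<sigma>"
    and l: "l \<in> {1..n j + 1}" and a: "a \<in> {1..n j + 1}"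
  defines "x \<equiv> \<lambda>w. \<lambda>(i, k)\<in>group_index J (n(j := n j + 1)). Z i k w"
  shows "\<P>(w in M. rank_in {1..n j + 1} (group_score J n j \<sigma> (x w)) l \<le> c) =
    \<P>(w in M. rank_in {1..n j + 1} (group_score J n j \<sigma> (x w)) a \<le> c)"
proof -
  let ?m = "n(j := n j + 1)" and ?A = "{1..n j + 1}"
  let ?I = "group_index J ?m"
  let ?P = "\<Pi>\<^sub>M p\<in>?I. (borel :: 'z measure)"
  let ?R = "\<lambda>y. rank_in ?A (group_score J n j \<sigma> y)"
  \<comment> \<open>The transposition sends \<open>a\<close> to \<open>l\<close>. Using the identity
    on all other groups keeps their data fixed, so the same conformity measure is evaluated before
    and after the swap.\<close>
  define \<tau> where "\<tau> = Transposition.transpose a l"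
  define \<pi> where "\<pi> k = (if k = j then \<tau> else id)" for k
  define x' where "x' = (\<lambda>w. \<lambda>(i, k)\<in>?I. Z (\<pi> k i) k w)"
  have \<tau>: "\<tau> permutes ?A" unfolding \<tau>_def using a l by (rule permutes_swap_id)
  have \<pi>: "\<pi> k permutes {1..?m k}" for k
    using \<tau> by (simp add: \<pi>_def permutes_id)
  have distr: "distr M ?P x' = distr M ?P x"
    using exch \<pi> unfolding partially_exchangeable_def x_def x'_def by blast
  have mx: "x \<in> M \<rightarrow>\<^sub>M ?P" unfolding x_def
    using Z by (intro measurable_restrict) auto
  have "(\<pi> k i, k) \<in> ?I" if "(i, k) \<in> ?I" for i k
    using that permutes_in_image[OF \<pi>, of k i] by (simp add: group_index_def)
  then have mx': "x' \<in> M \<rightarrow>\<^sub>M ?P" unfolding x'_def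
    using Z by (intro measurable_restrict) fast
  \<comment> \<open>This identity holds at every outcome; equality of laws is used only afterwards,
    to replace \<open>x'\<close> by \<open>x\<close> at the fixed index \<open>a\<close>.\<close>
  have swap: "?R (x' w) a = ?R (x w) l" for w
  proof -
    have "x' w p = x w p" if "p \<in> other_index J n j" for p
      using that other_index_subset[of J n j "n j + 1"]
      by (auto simp: x_def x'_def \<pi>_def other_index_def)
    moreover have "x' w (i, j) = x w (\<tau> i, j)" if "i \<in> ?A" for i
    proof -
      have "\<tau> i \<in> ?A" using permutes_in_image[OF \<tau>] that by blast
      then show ?thesis using mem_group_index_augmented[OF j, where n = n] that
        by (simp add: x_def x'_def \<pi>_def)
    qed
    ultimately have "?R (x' w) a = ?R (x w) (\<tau> a)"
      using group_score_permute[OF inv \<tau>] by (intro rank_in_permute \<tau> a) blast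
    then show ?thesis by (simp add: \<tau>_def)
  qed
  let ?E = "{y \<in> space ?P. ?R y a \<le> c}"
  have E: "?E \<in> sets ?P"
    by (intro borel_measurable_le borel_measurable_rank_in borel_measurable_const
        measurable_group_score cm j a)
  have "\<P>(w in M. ?R (x w) l \<le> c) = \<P>(w in M. ?R (x' w) a \<le> c)" by (simp only: swap)
  also have "\<dots> = measure (distr M ?P x') ?E"
    using measurable_space[OF mx'] by (subst measure_distr[OF mx' E]) (auto intro!: arg_cong[where f = "measure M"])
  also have "\<dots> = measure (distr M ?P x) ?E" by (simp only: distr)
  also have "\<dots> = \<P>(w in M. ?R (x w) a \<le> c)"
    using measurable_space[OF mx] by (subst measure_distr[OF mx E]) (auto intro!: arg_cong[where f = "measure M"])
  finally show ?thesis .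
qed

theorem proposition1:
  fixes M :: "'w measure"
    and J j :: nat
    and n :: "nat \<Rightarrow> nat"
    and Z :: "nat \<Rightarrow> nat \<Rightarrow> 'w \<Rightarrow> real \<times> (real ^ 'd)"
    and \<sigma> :: "(nat \<times> nat \<Rightarrow> real \<times> (real ^ 'd)) \<Rightarrow> (nat \<Rightarrow> real \<times> (real ^ 'd)) \<Rightarrow>
                real \<times> (real ^ 'd) \<Rightarrow> real"
    and \<alpha> :: real
  assumes "prob_space M"
    and "J \<ge> 1"
    and "\<forall>k\<in>{1..J}. n k \<ge> 1"
    and "j \<in> {1..J}"
    and "0 < \<alpha>" and "\<alpha> < 1"
    and "\<forall>(i, k)\<in>group_index J (n(j := n j + 1)). Z i k \<in> borel_measurable M"
    and "partially_exchangeable M J (n(j := n j + 1)) Z"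
    and "conformity_measure J n j \<sigma>"
    and "permutation_invariant J n j \<sigma>"
  shows "\<P>(w in M. fst (Z (n j + 1) j w) \<in>
            conformal_set (n j) (\<sigma> (other_groups J n j Z w)) \<alpha>
              (\<lambda>i. Z i j w) (snd (Z (n j + 1) j w))) \<ge> 1 - \<alpha>"
proof -
  interpret prob_space M by fact
  let ?A = "{1..n j + 1}" and ?I = "group_index J (n(j := n j + 1))"
  define x where "x = (\<lambda>w. \<lambda>(i, k)\<in>?I. Z i k w)"
  let ?S = "\<lambda>i w. group_score J n j \<sigma> (x w) i"
  let ?R = "\<lambda>w. rank_in ?A (\<lambda>i. ?S i w) (n j + 1)"
  let ?c = "\<alpha> * real (n j + 1)"
  have "x \<in> M \<rightarrow>\<^sub>M (\<Pi>\<^sub>M p\<in>?I. borel)" unfolding x_def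
    using assms(7) by (intro measurable_restrict) auto
  then have S: "random_variable borel (?S i)" if "i \<in> ?A" for i
    using measurable_compose[OF _ measurable_group_score[OF assms(9,4) that]] by blast
  \<comment> \<open>The threshold \<open>?c\<close> is \<alpha> times the number of scores, so
    dividing by \<open>card ?A\<close> leaves exactly \<alpha>.\<close>
  have "card ?A * \<P>(w in M. ?R w \<le> ?c) \<le> ?c"
  proof (rule prob_rank_in_le)
    show "\<P>(w in M. rank_in ?A (\<lambda>i. ?S i w) l \<le> ?c) = \<P>(w in M. ?R w \<le> ?c)" if "l \<in> ?A" for l
      using prob_group_rank_swap[OF assms(4,7-10) that, of "n j + 1" ?c] by (simp add: x_def)
  qed (use S assms(5) in auto)
  then have le: "\<P>(w in M. ?R w \<le> ?c) \<le> \<alpha>" by (simp add: mult.commute)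
  have E: "{w \<in> space M. ?R w \<le> ?c} \<in> events"
    by (intro borel_measurable_le borel_measurable_rank_in borel_measurable_const S) auto
  \<comment> \<open>Coverage is the strict inequality, matching the strict one in
    \<open>conformal_set\<close>, so miscoverage is exactly the event bounded above.\<close>
  have "\<P>(w in M. ?c < ?R w) = 1 - \<P>(w in M. ?R w \<le> ?c)"
    using prob_neg[OF E] by (simp add: not_le)
  then show ?thesis using le unfolding mem_conformal_set_iff[OF assms(4)] x_def by linarith
qed

end
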